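(* Let $q\in(0,1]$, let $\beta=\{\beta_n\}_{n=0}^\infty$ be a bounded real sequence, and let $T_\beta$ be the weighted shift operator on $A^2(\mathbb{D})$ defined by $T_\beta\left(\sum_{n=0}^\infty a_nz^n\right)=\sum_{n=0}^\infty a_n\beta_nz^{n+1}$. Then $\mathbf{Ber}_q(T_\beta)$ is a disc centered at the origin, hence convex.
   Context: $\mathbb{D}$ is the open unit disk; $A^2(\mathbb{D})$ is the Bergman space of holomorphic $f$ on $\mathbb{D}$ with $\int_{\mathbb{D}}|f|^2dA<\infty$, $dA$ being area measure normalized so that $\mathbb{D}$ has area $1$. Its normalized reproducing kernel is $\hat k_\lambda(z)=\frac{1-|\lambda|^2}{(1-\overline\lambda z)^2}$, $\lambda,z\in\mathbb{D}$. For a bounded operator $T$ on $A^2(\mathbb{D})$, $\mathbf{Ber}_q(T)=\{\langle T\hat k_\lambda,\hat k_\mu\rangle:\lambda,\mu\in\mathbb{D},\ \langle\hat k_\lambda,\hat k_\mu\rangle=q\}$. "Disc" means a circular disc in $\mathbb{C}$, open or closed (not specified which), with the degenerate disc $\{0\}$ allowed. *)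

theory Defs
  imports "HOL-Complex_Analysis.Complex_Analysis"
begin

abbreviation unit_disc :: "complex set" where
  "unit_disc \<equiv> ball 0 1"

definition area_measure :: "complex measure" where
  "area_measure = uniform_measure lborel unit_disc"

text \<open>Elements of the Bergman space are represented by total functions; their values outside
  the disc are arbitrary, and none of the notions below depends on them.\<close>

definition bergman_space :: "(complex \<Rightarrow> complex) set" where
  "bergman_space = {f. f holomorphic_on unit_disc \<and>
     set_integrable area_measure unit_disc (\<lambda>z. (norm (f z))\<^sup>2)}"

definition bergman_inner :: "(complex \<Rightarrow> complex) \<Rightarrow> (complex \<Rightarrow> complex) \<Rightarrow> complex" where
  "bergman_inner f g = (LINT z:unit_disc|area_measure. f z * cnj (g z))"

definition normalized_kernel :: "complex \<Rightarrow> complex \<Rightarrow> complex" where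
  "normalized_kernel l z = of_real (1 - (norm l)\<^sup>2) / (1 - cnj l * z)\<^sup>2"

definition berezin_range ::
  "complex \<Rightarrow> ((complex \<Rightarrow> complex) \<Rightarrow> (complex \<Rightarrow> complex)) \<Rightarrow> complex set" where
  "berezin_range q T =
     {bergman_inner (T (normalized_kernel l)) (normalized_kernel m) | l m.
        l \<in> unit_disc \<and> m \<in> unit_disc \<and>
        bergman_inner (normalized_kernel l) (normalized_kernel m) = q}"

text \<open>The coefficients of \<^term>\<open>fps_expansion f 0\<close> are the Taylor coefficients of \<^term>\<open>f\<close>
  at the origin, so that \<^term>\<open>f\<close> equals the sum of the series on the disc. The operator is
  unspecified outside the Bergman space.\<close>

definition weighted_shift :: "(nat \<Rightarrow> real) \<Rightarrow> (complex \<Rightarrow> complex) \<Rightarrow> (complex \<Rightarrow> complex)" where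
  "weighted_shift \<beta> =
     (\<lambda>f\<in>bergman_space. \<lambda>z. \<Sum>n. fps_nth (fps_expansion f 0) n * of_real (\<beta> n) * z ^ (n + 1))"

text \<open>A disc may be open or closed; it is nonempty, and the degenerate disc consisting of the
  origin alone is the closed one of radius zero.\<close>

definition disc_centered_at_0 :: "complex set \<Rightarrow> bool" where
  "disc_centered_at_0 S \<longleftrightarrow> (\<exists>r>0. S = ball 0 r) \<or> (\<exists>r\<ge>0. S = cball 0 r)"

end

theory Submission
  imports Defs
begin

text \<open>Since \<open>\<langle>k\<^sub>l, k\<^sub>m\<rangle> = (1 - |l|\<^sup>2) (1 - |m|\<^sup>2) / (1 - cnj l * m)\<^sup>2\<close> for the
  normalized kernels and \<open>Re (1 - cnj l * m) > 0\<close>, prescribing the value \<open>q > 0\<close> forces \<open>cnj l * m\<close>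
  to be real. Hence \<open>l = u x\<close> and \<open>m = u y\<close> with \<open>|u| = 1\<close> and real \<open>x\<close>, \<open>y\<close> at pseudo-hyperbolic
  distance \<open>s = sqrt (1 - q)\<close>; replacing \<open>u\<close> by \<open>- u\<close> if necessary, \<open>x = (y + s) / (1 + s y)\<close>.
  The quantity \<open>\<langle>T k\<^sub>l, k\<^sub>m\<rangle>\<close> is multiplied by \<open>u\<close> when both points are rotated by \<open>u\<close>, so the
  Berezin range is the union of the circles about the origin whose radii are the values of a
  continuous function of \<open>y\<close> on \<open>(-1, 1)\<close>. These radii form a bounded interval, which contains
  \<open>0\<close> as the value at \<open>y = 0\<close>.\<close>

section \<open>Orthogonality of monomials\<close>

text \<open>Two translation-invariant measures agree up to a factor by Fubini; testing against the unit
  ball, which the rotation preserves, shows that the factor is 1.\<close>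

lemma lborel_distr_unimodular:
  fixes c :: complex
  assumes "norm c = 1"
  shows "distr lborel borel ((*) c) = lborel"
proof (rule measure_eqI)
  show "sets (distr lborel borel ((*) c)) = sets lborel"
    by simp
next
  fix A assume "A \<in> sets (distr lborel borel ((*) c))"
  then have A [measurable]: "A \<in> sets borel" by simp
  define B where "B = ball (0::complex) 1"
  have [measurable]: "B \<in> sets borel" by (simp add: B_def)
  have shift: "(\<integral>\<^sup>+x. f (x + a) \<partial>lborel) = (\<integral>\<^sup>+x. f x \<partial>lborel)"
    if "f \<in> borel_measurable borel" for f :: "complex \<Rightarrow> ennreal" and a
    using that nn_integral_distr[of "(+) a" lborel borel f]
    by (simp add: lborel_distr_plus add.commute)
  have c: "c * cnj c = 1"
    using assms complex_norm_square[of c] by simp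
  then have cc: "c * (cnj c * w) = w" for w
    by (metis mult.assoc mult_1_left)
  \<comment> \<open>Multiplication by a unimodular \<open>c\<close> preserves distances, so this set
    is again a unit ball, with its volume independent of \<open>y\<close>.\<close>
  have ball_c: "{x. y - c * x \<in> B} = ball (cnj c * y) 1" for y
  proof -
    have "y - c * x = c * (cnj c * y - x)" for x
      by (simp add: right_diff_distrib cc)
    then show ?thesis
      using assms by (auto simp: B_def dist_norm norm_mult)
  qed
  have "emeasure (distr lborel borel ((*) c)) A * emeasure lborel B
      = (\<integral>\<^sup>+y. \<integral>\<^sup>+x. indicator A (c * x) * indicator B y \<partial>lborel \<partial>lborel)"
  proof -
    have "emeasure (distr lborel borel ((*) c)) A = (\<integral>\<^sup>+x. indicator A (c * x) \<partial>lborel)"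
      using nn_integral_distr[of "(*) c" lborel borel "indicator A"] by simp
    moreover have "(\<integral>\<^sup>+x. indicator A (c * x) * indicator B y \<partial>lborel)
        = (\<integral>\<^sup>+x. indicator A (c * x) \<partial>lborel) * (indicator B y :: ennreal)" for y
      by (rule nn_integral_multc) simp
    moreover have "(\<integral>\<^sup>+y. a * indicator B y \<partial>lborel) = a * emeasure lborel B" for a
      by (simp add: nn_integral_cmult_indicator)
    ultimately show ?thesis by simp
  qed
  \<comment> \<open>Translating \<open>x\<close> by \<open>cnj c * y\<close> couples the two
    variables; after the exchange of integrals, translating \<open>y\<close> by
    \<open>- c * x\<close> moves the coupling from \<open>A\<close> to \<open>B\<close>.\<close>
  also have "\<dots> = (\<integral>\<^sup>+y. \<integral>\<^sup>+x. indicator A (c * x + y) * indicator B y \<partial>lborel \<partial>lborel)"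
  proof (rule nn_integral_cong)
    fix y
    have *: "c * (x + cnj c * y) = c * x + y" for x
      by (simp add: distrib_left cc)
    show "(\<integral>\<^sup>+x. indicator A (c * x) * indicator B y \<partial>lborel) =
      (\<integral>\<^sup>+x. indicator A (c * x + y) * indicator B y \<partial>lborel :: ennreal)"
      by (subst shift[where a = "cnj c * y", symmetric]) (simp_all add: *)
  qed
  also have "\<dots> = (\<integral>\<^sup>+x. \<integral>\<^sup>+y. indicator A (c * x + y) * indicator B y \<partial>lborel \<partial>lborel)"
    by (rule lborel_pair.Fubini') measurable
  also have "\<dots> = (\<integral>\<^sup>+x. \<integral>\<^sup>+y. indicator A y * indicator B (y - c * x) \<partial>lborel \<partial>lborel)"
  proof (rule nn_integral_cong)
    fix x
    show "(\<integral>\<^sup>+y. indicator A (c * x + y) * indicator B y \<partial>lborel) =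
      (\<integral>\<^sup>+y. indicator A y * indicator B (y - c * x) \<partial>lborel :: ennreal)"
      by (subst shift[where a = "c * x", symmetric]) (simp_all add: add.commute)
  qed
  also have "\<dots> = (\<integral>\<^sup>+y. \<integral>\<^sup>+x. indicator A y * indicator B (y - c * x) \<partial>lborel \<partial>lborel)"
    by (rule lborel_pair.Fubini'[symmetric]) measurable
  also have "\<dots> = (\<integral>\<^sup>+y. indicator A y * emeasure lborel B \<partial>lborel)"
  proof (rule nn_integral_cong)
    fix y
    have "(\<integral>\<^sup>+x. indicator B (y - c * x) \<partial>lborel) = (\<integral>\<^sup>+x. indicator (ball (cnj c * y) 1) x \<partial>lborel :: ennreal)"
      unfolding ball_c[symmetric] by (simp add: indicator_def)
    then have "(\<integral>\<^sup>+x. indicator B (y - c * x) \<partial>lborel) = emeasure lborel B"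
      by (simp add: B_def emeasure_ball)
    then show "(\<integral>\<^sup>+x. indicator A y * indicator B (y - c * x) \<partial>lborel) =
      (indicator A y * emeasure lborel B :: ennreal)"
      by (subst nn_integral_cmult) simp_all
  qed
  also have "\<dots> = emeasure lborel A * emeasure lborel B"
    by (simp add: nn_integral_multc)
  \<comment> \<open>The common factor is the area pi of \<open>B\<close>, nonzero and finite, so it
    cancels in \<open>ennreal\<close>.\<close>
  finally show "emeasure (distr lborel borel ((*) c)) A = emeasure lborel A"
    by (simp add: B_def emeasure_ball unit_ball_vol_2 mult.commute[of _ "ennreal pi"]
        ennreal_mult_cancel_left)
qed

section \<open>Normalized area measure on the disc\<close>

lemma sets_area_measure [measurable_cong]: "sets area_measure = sets borel"
  by (simp add: area_measure_def)

lemma emeasure_unit_disc: "emeasure lborel unit_disc = ennreal pi"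
  by (simp add: emeasure_ball unit_ball_vol_2)

lemma emeasure_area_measure:
  assumes "A \<in> sets borel"
  shows "emeasure area_measure A = emeasure lborel (unit_disc \<inter> A) / ennreal pi"
  using assms by (simp add: area_measure_def emeasure_unit_disc)

interpretation area: finite_measure area_measure
  by (rule finite_measureI)
     (simp add: area_measure_def emeasure_unit_disc ennreal_divide_eq_top_iff)

lemma AE_area_measure: "AE z in area_measure. z \<in> unit_disc"
  unfolding area_measure_def by (rule AE_uniform_measureI) auto

lemma area_measure_rotate:
  assumes "norm c = 1"
  shows "distr area_measure borel ((*) c) = area_measure"
proof (rule measure_eqI)
  fix A assume "A \<in> sets (distr area_measure borel ((*) c))"
  then have A [measurable]: "A \<in> sets borel" by simp
  have *: "unit_disc \<inter> (*) c -` A = (*) c -` (unit_disc \<inter> A)"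
    using assms by (auto simp: norm_mult)
  have "emeasure lborel (unit_disc \<inter> (*) c -` A) = emeasure (distr lborel borel ((*) c)) (unit_disc \<inter> A)"
    unfolding * by (subst emeasure_distr) auto
  then have "emeasure lborel (unit_disc \<inter> (*) c -` A) = emeasure lborel (unit_disc \<inter> A)"
    unfolding lborel_distr_unimodular[OF assms] .
  moreover have "(*) c -` A \<in> sets borel"
    using measurable_sets[of "(*) c" borel borel A] by simp
  ultimately show "emeasure (distr area_measure borel ((*) c)) A = emeasure area_measure A"
    by (subst emeasure_distr) (simp_all add: emeasure_area_measure area_measure_def emeasure_unit_disc)
qed (simp add: sets_area_measure)

text \<open>The concentric disc of radius \<open>sqrt t\<close> fills the fraction \<open>t\<close>
  of the unit disc, so the squared modulus of a uniformly distributed point is uniform on [0,1].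
  This takes the place of polar coordinates.\<close>

lemma area_measure_norm_squared:
  "distr area_measure borel (\<lambda>z. (norm z)\<^sup>2) = density lborel (indicator {0..1::real})"
proof (rule measure_eqI_lessThan)
  fix x :: real
  have eq: "emeasure (distr area_measure borel (\<lambda>z. (norm z)\<^sup>2)) {x<..} =
      emeasure lborel {z \<in> unit_disc. x < (norm z)\<^sup>2} / ennreal pi"
    by (subst emeasure_distr)
       (auto simp: emeasure_area_measure area_measure_def emeasure_unit_disc vimage_def Int_def
        intro!: arg_cong2[where f="(/)"] arg_cong[where f="emeasure lborel"])
  show "emeasure (distr area_measure borel (\<lambda>z. (norm z)\<^sup>2)) {x<..} < \<infinity>"
    by (subst emeasure_distr) (simp_all add: less_top[symmetric])
  \<comment> \<open>Clamping \<open>x\<close> to [0,1] gives the single formula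
    \<open>pi * (1 - t)\<close> for the area. Negative \<open>x\<close> is still separated below,
    because there nothing is removed, whereas \<open>cball 0 0\<close> would remove the
    origin.\<close>
  define t where "t = min 1 (max 0 x)"
  have t: "0 \<le> t" "t \<le> 1" by (auto simp: t_def)
  have "{z \<in> unit_disc. x < (norm z)\<^sup>2} = unit_disc - (if x < 0 then {} else cball 0 (sqrt t))"
  proof (cases "x < 0")
    case True
    then show ?thesis by (auto intro: less_le_trans)
  next
    case False
    have "x < (norm z)\<^sup>2 \<longleftrightarrow> \<not> norm z \<le> sqrt t" if "norm z < 1" for z :: complex
    proof -
      have "(norm z)\<^sup>2 < 1" using that by (simp add: power_less_one_iff abs_square_less_1)
      then have "x < (norm z)\<^sup>2 \<longleftrightarrow> t < (norm z)\<^sup>2"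
        using False by (auto simp: t_def)
      also have "\<dots> \<longleftrightarrow> sqrt t < norm z"
        using t real_sqrt_less_iff[of t "(norm z)\<^sup>2"] by simp
      finally show ?thesis by auto
    qed
    then show ?thesis using False by auto
  qed
  moreover have "emeasure lborel (unit_disc - (if x < 0 then {} else cball 0 (sqrt t))) = ennreal (pi * (1 - t))"
  proof (cases "x < 0")
    case True
    then show ?thesis by (simp add: emeasure_unit_disc t_def)
  next
    case False
    have "emeasure lborel (cball 0 (sqrt t) \<inter> unit_disc) = ennreal (pi * t)"
    proof (cases "t = 1")
      case True
      then have "cball 0 (sqrt t) \<inter> unit_disc = unit_disc" by auto
      then show ?thesis using True by (simp add: emeasure_unit_disc)
    next
      case False
      then have "sqrt t < 1" using t by simp
      then have "cball 0 (sqrt t) \<inter> unit_disc = (cball 0 (sqrt t) :: complex set)"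
        by (auto simp del: real_sqrt_lt_1_iff intro: le_less_trans)
      then show ?thesis
        using t emeasure_cball[of "sqrt t" "0 :: complex"] by (simp add: unit_ball_vol_2)
    qed
    moreover have "unit_disc - cball 0 (sqrt t) = unit_disc - (cball 0 (sqrt t) \<inter> unit_disc)"
      by auto
    ultimately have "emeasure lborel (unit_disc - cball 0 (sqrt t)) = ennreal pi - ennreal (pi * t)"
      by (simp only:) (subst emeasure_Diff, simp_all add: emeasure_unit_disc)
    then show ?thesis
      using t False by (simp add: ennreal_minus algebra_simps)
  qed
  moreover have "emeasure (density lborel (indicator {0..1::real})) {x<..} = ennreal (1 - t)"
  proof -
    have "emeasure (density lborel (indicator {0..1::real})) {x<..} = emeasure lborel ({0..1} \<inter> {x<..})"
      by (subst emeasure_density) (simp_all add: indicator_inter_arith[symmetric])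
    also have "{0..1} \<inter> {x<..} = (if x < 0 then {0..1} else {t<..1})"
      by (auto simp: t_def)
    finally show ?thesis using t by (auto simp: t_def)
  qed
  ultimately show "emeasure (distr area_measure borel (\<lambda>z. (norm z)\<^sup>2)) {x<..} =
    emeasure (density lborel (indicator {0..1})) {x<..}"
    using t by (simp add: eq divide_ennreal)
qed simp_all

lemma integrable_area_bounded:
  fixes f :: "complex \<Rightarrow> 'a :: {banach, second_countable_topology}"
  assumes "f \<in> borel_measurable borel" "\<And>z. z \<in> unit_disc \<Longrightarrow> norm (f z) \<le> B"
  shows "integrable area_measure f"
proof (rule area.integrable_const_bound)
  show "AE z in area_measure. norm (f z) \<le> B"
    using AE_area_measure by eventually_elim (use assms in auto)
qed (use assms in measurable)

lemma integral_norm_power_area: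
  "(\<integral>z. complex_of_real ((norm z)\<^sup>2 ^ n) \<partial>area_measure) = 1 / of_nat (Suc n)"
proof -
  have "(\<integral>z. (norm z)\<^sup>2 ^ n \<partial>area_measure)
      = (\<integral>u. u ^ n \<partial>distr area_measure borel (\<lambda>z. (norm z)\<^sup>2))"
    by (subst integral_distr) simp_all
  also have "\<dots> = (\<integral>u. u ^ n * indicator {0..1} u \<partial>lborel)"
    unfolding area_measure_norm_squared
    using integral_density[of "\<lambda>u::real. u ^ n" lborel "indicator {0..1}"]
    by (simp add: ennreal_indicator mult.commute)
  also have "\<dots> = 1 / real (Suc n)"
    by (subst integral_power) auto
  finally show ?thesis
    by (subst integral_complex_of_real) simp
qed

text \<open>On the diagonal the integrand is a power of the squared modulus. Off the diagonal a
  suitable rotation changes the sign of the integrand but not the integral.\<close>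

lemma integral_monomials_area:
  "(\<integral>z. z ^ m * cnj z ^ n \<partial>area_measure) = (if m = n then 1 / of_nat (Suc n) else 0)"
proof (cases "m = n")
  case True
  have "z ^ n * cnj z ^ n = complex_of_real ((norm z)\<^sup>2 ^ n)" for z
    by (metis complex_norm_square of_real_power power_mult_distrib)
  then show ?thesis
    using True integral_norm_power_area[of n] by simp
next
  case False
  \<comment> \<open>The angle is chosen so that \<open>(m - n) * \<theta> = pi\<close>: rotating by
    it multiplies the integrand by \<open>cis pi = -1\<close>.\<close>
  define \<theta> where "\<theta> = pi / (real m - real n)"
  define c where "c = cis \<theta>"
  have "c ^ m * cnj c ^ n = cis ((real m - real n) * \<theta>)"
    by (simp add: c_def cis_cnj Complex.DeMoivre cis_mult left_diff_distrib)
  then have "c ^ m * cnj c ^ n = cis pi"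
    using False by (simp add: \<theta>_def)
  then have c: "c ^ m * cnj c ^ n = -1" by simp
  let ?I = "\<integral>z. z ^ m * cnj z ^ n \<partial>area_measure"
  have "?I = (\<integral>z. z ^ m * cnj z ^ n \<partial>distr area_measure borel ((*) c))"
    by (subst area_measure_rotate) (simp_all add: c_def)
  also have "\<dots> = (\<integral>z. (c ^ m * cnj c ^ n) * (z ^ m * cnj z ^ n) \<partial>area_measure)"
    by (subst integral_distr)
       (auto simp: power_mult_distrib mult_ac intro!: borel_measurable_continuous_onI continuous_intros)
  also have "\<dots> = - ?I"
    unfolding c by simp
  finally show ?thesis using False by simp
qed

section \<open>Inner products of power series\<close>

text \<open>A summable uniform bound, as in the Weierstrass M-test, is enough to integrate termwise
  because the measure is finite.\<close>

lemma sums_integral_area: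
  fixes h :: "nat \<Rightarrow> complex \<Rightarrow> complex"
  assumes h: "\<And>n. continuous_on unit_disc (h n)"
    and B: "\<And>n z. z \<in> unit_disc \<Longrightarrow> norm (h n z) \<le> B n" "summable B"
    and s: "\<And>z. z \<in> unit_disc \<Longrightarrow> (\<lambda>n. h n z) sums s z"
  shows "(\<lambda>n. LINT z:unit_disc|area_measure. h n z) sums (LINT z:unit_disc|area_measure. s z)"
proof -
  let ?h = "\<lambda>n z. indicator unit_disc z *\<^sub>R h n z"
  have B0: "0 \<le> B n" for n
    using order_trans[OF norm_ge_zero B(1)[of 0 n]] by simp
  have bound: "norm (?h n z) \<le> B n" for n z
    using B(1)[of z n] B0 by (auto simp: indicator_def)
  have meas: "?h n \<in> borel_measurable borel" for n
    using h by (intro borel_measurable_continuous_on_indicator) auto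
  have int: "integrable area_measure (?h n)" for n
    by (rule integrable_area_bounded[OF meas bound])
  have "(\<lambda>n. \<integral>z. ?h n z \<partial>area_measure) sums (\<integral>z. (\<Sum>n. ?h n z) \<partial>area_measure)"
  proof (rule sums_integral[OF int])
    show "AE z in area_measure. summable (\<lambda>n. norm (?h n z))"
      by (intro AE_I2 summable_comparison_test'[OF B(2)]) (use bound in auto)
    show "summable (\<lambda>n. \<integral>z. norm (?h n z) \<partial>area_measure)"
    proof (rule summable_comparison_test')
      show "summable (\<lambda>n. B n * measure area_measure (space area_measure))"
        by (rule summable_mult2[OF B(2)])
      fix n
      have "(\<integral>z. norm (?h n z) \<partial>area_measure) \<le> (\<integral>z. B n \<partial>area_measure)"
        by (rule integral_mono[OF integrable_norm[OF int]]) (simp, rule bound)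
      then show "norm (\<integral>z. norm (?h n z) \<partial>area_measure) \<le> B n * measure area_measure (space area_measure)"
        by (simp add: mult.commute)
    qed
  qed
  moreover have "(\<Sum>n. ?h n z) = indicator unit_disc z *\<^sub>R s z" for z
    using s[of z] by (auto simp: indicator_def sums_iff)
  ultimately show ?thesis
    by (simp add: set_lebesgue_integral_def)
qed

lemma norm_power_series_term_le:
  fixes z :: complex
  assumes "z \<in> unit_disc"
  shows "norm (a n * z ^ n) \<le> norm (a n)"
  using assms by (simp add: norm_mult norm_power mult_left_le power_le_one)

lemma norm_power_series_le:
  assumes "summable (\<lambda>n. norm (a n))" "z \<in> unit_disc" "(\<lambda>n. a n * z ^ n) sums f z"
  shows "norm (f z) \<le> (\<Sum>n. norm (a n))"
proof -
  have "norm (\<Sum>n. a n * z ^ n) \<le> (\<Sum>n. norm (a n))"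
    using norm_suminf_le[of "\<lambda>n. a n * z ^ n" "\<lambda>n. norm (a n)"]
      norm_power_series_term_le[OF assms(2), of a] assms(1) by blast
  then show ?thesis using assms(3) by (simp add: sums_iff)
qed

lemma power_series_holomorphic_unit_disc:
  assumes "\<And>z. z \<in> unit_disc \<Longrightarrow> (\<lambda>n. a n * z ^ n) sums f z"
  shows "f holomorphic_on unit_disc"
  by (rule power_series_holomorphic) (use assms in simp)

text \<open>The series are expanded one after the other, so that only single sums are ever exchanged
  with the integral. Absolutely summable coefficients bound both series uniformly on the
  disc.\<close>

lemma sums_bergman_inner:
  assumes a: "summable (\<lambda>n. norm (a n))" and b: "summable (\<lambda>n. norm (b n))"
    and f: "\<And>z. z \<in> unit_disc \<Longrightarrow> (\<lambda>n. a n * z ^ n) sums f z"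
    and g: "\<And>z. z \<in> unit_disc \<Longrightarrow> (\<lambda>n. b n * z ^ n) sums g z"
  shows "(\<lambda>n. a n * cnj (b n) / of_nat (Suc n)) sums bergman_inner f g"
proof -
  have cont_g: "continuous_on unit_disc g"
    by (rule holomorphic_on_imp_continuous_on[OF power_series_holomorphic_unit_disc[OF g]])
  have mono: "(LINT z:unit_disc|area_measure. c * (z ^ m * cnj z ^ n))
      = c * (if m = n then 1 / of_nat (Suc n) else 0)" for c m n
  proof -
    have "(\<lambda>z. c * (z ^ m * cnj z ^ n)) \<in> borel_measurable borel"
      by (intro borel_measurable_continuous_onI continuous_intros)
    moreover have "(\<lambda>z. indicat_real unit_disc z *\<^sub>R (c * (z ^ m * cnj z ^ n))) \<in> borel_measurable borel"
      by (intro borel_measurable_continuous_on_indicator continuous_intros) auto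
    ultimately have "(LINT z:unit_disc|area_measure. c * (z ^ m * cnj z ^ n))
        = (\<integral>z. c * (z ^ m * cnj z ^ n) \<partial>area_measure)"
      unfolding set_lebesgue_integral_def
      by (intro integral_cong_AE eventually_mono[OF AE_area_measure])
         (auto simp: measurable_cong_sets[OF sets_area_measure refl])
    then show ?thesis
      by (simp add: integral_monomials_area)
  qed
  \<comment> \<open>Expanding \<open>g\<close> against one monomial: orthogonality leaves only the
    term with index \<open>m\<close>.\<close>
  have inner_g: "(LINT z:unit_disc|area_measure. z ^ m * cnj (g z)) = cnj (b m) / of_nat (Suc m)" for m
  proof -
    have "(\<lambda>n. LINT z:unit_disc|area_measure. cnj (b n) * (z ^ m * cnj z ^ n)) sums
        (LINT z:unit_disc|area_measure. z ^ m * cnj (g z))"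
    proof (rule sums_integral_area[OF _ _ b])
      show "norm (cnj (b n) * (z ^ m * cnj z ^ n)) \<le> norm (b n)" if "z \<in> unit_disc" for n z
        using that by (simp add: norm_mult norm_power mult_left_le power_le_one mult_le_one)
      show "(\<lambda>n. cnj (b n) * (z ^ m * cnj z ^ n)) sums (z ^ m * cnj (g z))" if "z \<in> unit_disc" for z
      proof -
        have "(\<lambda>n. cnj (b n * z ^ n)) sums cnj (g z)"
          using g[OF that] by (simp only: sums_cnj)
        then have "(\<lambda>n. z ^ m * cnj (b n * z ^ n)) sums (z ^ m * cnj (g z))"
          by (rule sums_mult)
        then show ?thesis by (simp add: mult_ac)
      qed
    qed (intro continuous_intros)
    moreover have "(\<lambda>n. cnj (b n) * (if m = n then 1 / of_nat (Suc n) else 0)) sums (cnj (b m) / of_nat (Suc m))"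
      using sums_single[of m "\<lambda>n. cnj (b n) / of_nat (Suc n)"]
      by (rule sums_cong[THEN iffD1, rotated]) auto
    ultimately show ?thesis
      unfolding mono by (rule sums_unique2)
  qed
  \<comment> \<open>Now \<open>f\<close> is expanded, with \<open>g\<close> kept whole and bounded
    by the sum of the norms of its coefficients.\<close>
  have "(\<lambda>n. LINT z:unit_disc|area_measure. a n * (z ^ n * cnj (g z))) sums
      (LINT z:unit_disc|area_measure. f z * cnj (g z))"
  proof (rule sums_integral_area)
    show "continuous_on unit_disc (\<lambda>z. a n * (z ^ n * cnj (g z)))" for n
      by (intro continuous_intros cont_g)
    show "norm (a n * (z ^ n * cnj (g z))) \<le> norm (a n) * (\<Sum>n. norm (b n))"
      if z: "z \<in> unit_disc" for n z
    proof -
      have "norm (a n * (z ^ n * cnj (g z))) = norm (a n * z ^ n) * norm (g z)"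
        by (simp add: norm_mult)
      also have "\<dots> \<le> norm (a n) * (\<Sum>n. norm (b n))"
        by (intro mult_mono norm_power_series_term_le norm_power_series_le z b g) auto
      finally show ?thesis .
    qed
    show "summable (\<lambda>n. norm (a n) * (\<Sum>n. norm (b n)))"
      by (rule summable_mult2[OF a])
    show "(\<lambda>n. a n * (z ^ n * cnj (g z))) sums (f z * cnj (g z))" if "z \<in> unit_disc" for z
      using sums_mult2[OF f[OF that], of "cnj (g z)"] by (simp add: mult_ac)
  qed
  then show ?thesis
    by (simp add: bergman_inner_def inner_g del: of_nat_Suc)
qed

section \<open>Taylor coefficients and inner products of the kernels\<close>

definition kernel_coeff :: "complex \<Rightarrow> nat \<Rightarrow> complex" where
  "kernel_coeff l n = of_real (1 - (norm l)\<^sup>2) * of_nat (Suc n) * cnj l ^ n"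

text \<open>Up to the normalizing factor, the kernel is the derivative of the geometric series
  evaluated at \<open>cnj l * z\<close>.\<close>

lemma normalized_kernel_sums:
  assumes "l \<in> unit_disc" "z \<in> unit_disc"
  shows "(\<lambda>n. kernel_coeff l n * z ^ n) sums normalized_kernel l z"
proof -
  have "norm (cnj l * z) < 1"
    using assms mult_strict_mono'[of "norm l" 1 "norm z" 1] by (simp add: norm_mult)
  from sums_mult[OF geometric_deriv_sums[OF this], of "of_real (1 - (norm l)\<^sup>2)"]
  show ?thesis
    by (simp add: kernel_coeff_def normalized_kernel_def power_mult_distrib mult_ac del: of_nat_Suc of_real_diff)
qed

lemma summable_kernel_coeff:
  assumes "l \<in> unit_disc"
  shows "summable (\<lambda>n. norm (kernel_coeff l n))"
proof -
  have "summable (\<lambda>n. of_nat (Suc n) * norm l ^ n)"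
    using assms geometric_deriv_sums[of "norm l"] by (simp add: sums_iff)
  from summable_mult[OF this, of "\<bar>1 - (norm l)\<^sup>2\<bar>"] show ?thesis
    by (simp add: kernel_coeff_def norm_mult norm_power mult.assoc del: of_nat_Suc of_real_diff)
qed

lemma fps_nth_normalized_kernel:
  assumes "l \<in> unit_disc"
  shows "fps_nth (fps_expansion (normalized_kernel l) 0) n = kernel_coeff l n"
proof -
  have "eventually (\<lambda>z. z \<in> unit_disc) (nhds (0::complex))"
    by (rule eventually_nhds_in_open) auto
  then have "normalized_kernel l has_fps_expansion Abs_fps (kernel_coeff l)"
    by (intro has_fps_expansionI, eventually_elim) (use normalized_kernel_sums[OF assms] in simp)
  then show ?thesis by (simp add: fps_expansion_eqI)
qed

text \<open>Membership is what allows \<open>weighted_shift\<close> to be unfolded at a kernel. It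
  holds because the kernel is bounded on the disc by the sum of the norms of its
  coefficients.\<close>

lemma normalized_kernel_in_bergman_space:
  assumes "l \<in> unit_disc"
  shows "normalized_kernel l \<in> bergman_space"
proof -
  let ?f = "normalized_kernel l"
  have hol: "?f holomorphic_on unit_disc"
    by (rule power_series_holomorphic_unit_disc[OF normalized_kernel_sums[OF assms]])
  have "(\<lambda>z. indicator unit_disc z *\<^sub>R (norm (?f z))\<^sup>2) \<in> borel_measurable borel"
    using holomorphic_on_imp_continuous_on[OF hol]
    by (intro borel_measurable_continuous_on_indicator continuous_intros) auto
  moreover have "norm (indicator unit_disc z *\<^sub>R (norm (?f z))\<^sup>2) \<le> (\<Sum>n. norm (kernel_coeff l n))\<^sup>2"
    if "z \<in> unit_disc" for z
    using that
      norm_power_series_le[of "kernel_coeff l" z ?f, OF summable_kernel_coeff[OF assms] that normalized_kernel_sums[OF assms that]]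
    by (simp add: power_mono)
  ultimately show ?thesis
    using hol integrable_area_bounded unfolding bergman_space_def set_integrable_def by blast
qed

text \<open>This is the reproducing property at \<open>m\<close>: the factor \<open>Suc n\<close> in
  the coefficient of the second kernel cancels the squared norm \<open>1 / Suc n\<close> of the
  monomial, which leaves the Taylor series of the first kernel at \<open>m\<close>.\<close>

lemma bergman_inner_kernels:
  assumes "l \<in> unit_disc" "m \<in> unit_disc"
  shows "bergman_inner (normalized_kernel l) (normalized_kernel m) =
    of_real ((1 - (norm l)\<^sup>2) * (1 - (norm m)\<^sup>2)) / (1 - cnj l * m)\<^sup>2"
proof -
  have "(\<lambda>n. kernel_coeff l n * cnj (kernel_coeff m n) / of_nat (Suc n)) sums
      bergman_inner (normalized_kernel l) (normalized_kernel m)"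
    by (intro sums_bergman_inner summable_kernel_coeff normalized_kernel_sums assms)
  moreover have "kernel_coeff l n * cnj (kernel_coeff m n) / of_nat (Suc n)
      = of_real (1 - (norm m)\<^sup>2) * (kernel_coeff l n * m ^ n)" for n
    by (simp add: kernel_coeff_def del: of_nat_Suc of_real_diff)
  ultimately have "(\<lambda>n. of_real (1 - (norm m)\<^sup>2) * (kernel_coeff l n * m ^ n)) sums
      bergman_inner (normalized_kernel l) (normalized_kernel m)"
    by simp
  moreover note sums_mult[OF normalized_kernel_sums[OF assms], of "of_real (1 - (norm m)\<^sup>2)"]
  ultimately show ?thesis
    by (auto dest: sums_unique2 simp: normalized_kernel_def mult_ac)
qed

section \<open>The weighted shift on kernels\<close>

definition shift_symbol :: "(nat \<Rightarrow> real) \<Rightarrow> complex \<Rightarrow> complex" where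
  "shift_symbol \<beta> w = (\<Sum>n. of_nat (Suc n) * of_real (\<beta> n) * w ^ n)"

text \<open>Termwise comparison with \<open>B\<close> times the derivative of the geometric series
  at \<open>norm w\<close>.\<close>

lemma shift_symbol_bound:
  assumes "\<And>n. \<bar>\<beta> n\<bar> \<le> B" "norm w < 1"
  shows "summable (\<lambda>n. of_nat (Suc n) * of_real (\<beta> n) * w ^ n)"
    and "norm (shift_symbol \<beta> w) \<le> B / (1 - norm w)\<^sup>2"
proof -
  let ?b = "\<lambda>n. B * (of_nat (Suc n) * norm w ^ n)"
  have b: "?b sums (B / (1 - norm w)\<^sup>2)"
    using sums_mult[OF geometric_deriv_sums[of "norm w"], of B] assms by simp
  have le: "norm (of_nat (Suc n) * of_real (\<beta> n) * w ^ n) \<le> ?b n" for n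
  proof -
    have "norm (of_nat (Suc n) * of_real (\<beta> n) * w ^ n) = \<bar>\<beta> n\<bar> * (of_nat (Suc n) * norm w ^ n)"
      by (simp add: norm_mult norm_power del: of_nat_Suc)
    also have "\<dots> \<le> ?b n"
      by (intro mult_right_mono assms) auto
    finally show ?thesis .
  qed
  show "summable (\<lambda>n. of_nat (Suc n) * of_real (\<beta> n) * w ^ n)"
    by (rule summable_comparison_test'[OF sums_summable[OF b]]) (rule le)
  show "norm (shift_symbol \<beta> w) \<le> B / (1 - norm w)\<^sup>2"
    unfolding shift_symbol_def
    using norm_suminf_le[OF le sums_summable[OF b]] b by (simp add: sums_iff)
qed

lemma continuous_on_shift_symbol:
  assumes "\<And>n. \<bar>\<beta> n\<bar> \<le> B"
  shows "continuous_on unit_disc (shift_symbol \<beta>)"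
proof (rule continuous_at_imp_continuous_on, rule ballI)
  fix w :: complex assume "w \<in> unit_disc"
  \<comment> \<open>Continuity at \<open>w\<close> follows from convergence at a point of strictly
    larger modulus that is still inside the disc.\<close>
  then obtain r where r: "norm w < r" "r < 1" using dense by auto
  then have "0 < r" by (auto intro: le_less_trans[OF norm_ge_zero])
  then show "isCont (shift_symbol \<beta>) w"
    unfolding shift_symbol_def[abs_def]
    using r shift_symbol_bound(1)[OF assms, of "of_real r"]
    by (intro isCont_powser[where K = "of_real r"]) auto
qed

definition berezin_value :: "(nat \<Rightarrow> real) \<Rightarrow> complex \<Rightarrow> complex \<Rightarrow> complex" where
  "berezin_value \<beta> l m =
     of_real ((1 - (norm l)\<^sup>2) * (1 - (norm m)\<^sup>2)) * m * shift_symbol \<beta> (cnj l * m)"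

text \<open>The shift raises each degree by one, so the factor \<open>Suc (Suc n)\<close> of the
  kernel at \<open>m\<close> now cancels the monomial norm. The factor \<open>Suc n\<close> of the
  kernel at \<open>l\<close> survives into the symbol, and one extra power of \<open>m\<close> comes
  out.\<close>

lemma bergman_inner_weighted_shift_kernels:
  assumes \<beta>: "\<And>n. \<bar>\<beta> n\<bar> \<le> B" and l: "l \<in> unit_disc" and m: "m \<in> unit_disc"
  shows "bergman_inner (weighted_shift \<beta> (normalized_kernel l)) (normalized_kernel m) =
    berezin_value \<beta> l m"
proof -
  \<comment> \<open>These are the Taylor coefficients of the image of the kernel; the vanishing
    constant term lets every series below start at index 1.\<close>
  define a where "a n = (case n of 0 \<Rightarrow> 0 | Suc k \<Rightarrow> kernel_coeff l k * of_real (\<beta> k))" for n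
  have a_Suc: "a (Suc n) = kernel_coeff l n * of_real (\<beta> n)" and a_0: "a 0 = 0" for n
    by (simp_all add: a_def)
  have "summable (\<lambda>n. norm (a (Suc n)))"
  proof (rule summable_comparison_test')
    show "summable (\<lambda>n. norm (kernel_coeff l n) * B)"
      by (rule summable_mult2[OF summable_kernel_coeff[OF l]])
    show "norm (norm (a (Suc n))) \<le> norm (kernel_coeff l n) * B" for n
      using \<beta>[of n] by (simp add: a_Suc norm_mult mult_left_mono)
  qed
  then have a: "summable (\<lambda>n. norm (a n))"
    using summable_Suc_iff[of "\<lambda>n. norm (a n)"] by simp
  have f: "(\<lambda>n. a n * z ^ n) sums weighted_shift \<beta> (normalized_kernel l) z" if z: "z \<in> unit_disc" for z
  proof -
    have "summable (\<lambda>n. a n * z ^ n)"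
      by (rule summable_comparison_test'[OF a]) (rule norm_power_series_term_le[OF z])
    then have "(\<lambda>n. a (Suc n) * z ^ Suc n) sums (\<Sum>n. a (Suc n) * z ^ Suc n)"
      using summable_Suc_iff[of "\<lambda>n. a n * z ^ n"] by (intro summable_sums) simp
    moreover have "(\<Sum>n. a (Suc n) * z ^ Suc n) = weighted_shift \<beta> (normalized_kernel l) z"
      using normalized_kernel_in_bergman_space[OF l]
      by (simp add: weighted_shift_def fps_nth_normalized_kernel[OF l] a_Suc)
    ultimately show ?thesis
      using sums_Suc_iff[of "\<lambda>n. a n * z ^ n" "weighted_shift \<beta> (normalized_kernel l) z"]
      by (simp add: a_0)
  qed
  let ?I = "bergman_inner (weighted_shift \<beta> (normalized_kernel l)) (normalized_kernel m)"
  have "(\<lambda>n. a n * cnj (kernel_coeff m n) / of_nat (Suc n)) sums ?I"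
    by (intro sums_bergman_inner a f summable_kernel_coeff normalized_kernel_sums m)
  then have "(\<lambda>n. a (Suc n) * cnj (kernel_coeff m (Suc n)) / of_nat (Suc (Suc n))) sums ?I"
    using sums_Suc_iff[of "\<lambda>n. a n * cnj (kernel_coeff m n) / of_nat (Suc n)" ?I] by (simp add: a_0)
  moreover have "a (Suc n) * cnj (kernel_coeff m (Suc n)) / of_nat (Suc (Suc n)) =
      of_real ((1 - (norm l)\<^sup>2) * (1 - (norm m)\<^sup>2)) * m *
        (of_nat (Suc n) * of_real (\<beta> n) * (cnj l * m) ^ n)" for n
    by (simp add: a_Suc kernel_coeff_def power_mult_distrib del: of_nat_Suc of_real_diff)
  ultimately have "(\<lambda>n. of_real ((1 - (norm l)\<^sup>2) * (1 - (norm m)\<^sup>2)) * m *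
        (of_nat (Suc n) * of_real (\<beta> n) * (cnj l * m) ^ n)) sums ?I"
    by (simp only:)
  moreover have "norm (cnj l * m) < 1"
    using l m mult_strict_mono'[of "norm l" 1 "norm m" 1] by (simp add: norm_mult)
  then have "(\<lambda>n. of_real ((1 - (norm l)\<^sup>2) * (1 - (norm m)\<^sup>2)) * m *
        (of_nat (Suc n) * of_real (\<beta> n) * (cnj l * m) ^ n)) sums berezin_value \<beta> l m"
    unfolding berezin_value_def shift_symbol_def
    by (intro sums_mult summable_sums shift_symbol_bound(1)[OF \<beta>])
  ultimately show ?thesis by (rule sums_unique2)
qed

text \<open>A common rotation fixes both moduli and \<open>cnj l * m\<close>, so only the isolated
  factor \<open>m\<close> turns.\<close>

lemma berezin_value_rotate:
  assumes "norm u = 1"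
  shows "berezin_value \<beta> (u * l) (u * m) = u * berezin_value \<beta> l m"
proof -
  have "cnj u * u = 1" using assms complex_norm_square[of u] by (simp add: mult.commute)
  then have eq: "cnj (u * l) * (u * m) = cnj l * m"
    by (metis (no_types, lifting) complex_cnj_mult mult.assoc mult.left_commute mult_1_left)
  have norms: "norm (u * l) = norm l" "norm (u * m) = norm m"
    using assms by (simp_all add: norm_mult)
  show ?thesis
    unfolding berezin_value_def eq norms by (simp only: mult_ac)
qed

text \<open>The geometric bound on the symbol is absorbed by
  \<open>(1 - x^2) * (1 - y^2) <= (1 - x * y)^2\<close>, the Cauchy-Schwarz inequality for two
  kernels; the difference of the two sides is \<open>(x - y)^2\<close>.\<close>

lemma norm_berezin_value_le:
  assumes "\<And>n. \<bar>\<beta> n\<bar> \<le> B" and l: "l \<in> unit_disc" and m: "m \<in> unit_disc"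
  shows "norm (berezin_value \<beta> l m) \<le> B"
proof -
  define x y where "x = norm l" and "y = norm m"
  have xy: "0 \<le> x" "x < 1" "0 \<le> y" "y < 1" using l m by (auto simp: x_def y_def)
  then have w: "x * y < 1" using mult_strict_mono'[of x 1 y 1] by simp
  have B: "0 \<le> B" using assms(1)[of 0] by linarith
  have sq: "0 \<le> 1 - x\<^sup>2" "0 \<le> 1 - y\<^sup>2"
    using xy by (auto simp: power_le_one)
  have "norm (berezin_value \<beta> l m) =
      (1 - x\<^sup>2) * (1 - y\<^sup>2) * y * norm (shift_symbol \<beta> (cnj l * m))"
    using sq by (simp add: berezin_value_def norm_mult x_def y_def del: of_real_diff)
  also have "\<dots> \<le> (1 - x\<^sup>2) * (1 - y\<^sup>2) * 1 * (B / (1 - x * y)\<^sup>2)"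
    using xy sq w shift_symbol_bound(2)[OF assms(1), of "cnj l * m"]
    by (intro mult_mono) (auto simp: norm_mult x_def y_def)
  also have "(1 - x\<^sup>2) * (1 - y\<^sup>2) * 1 * (B / (1 - x * y)\<^sup>2) \<le> B"
  proof -
    have "(1 - x\<^sup>2) * (1 - y\<^sup>2) \<le> (1 - x * y)\<^sup>2"
      using zero_le_power2[of "x - y"] by (simp add: power2_eq_square algebra_simps)
    then have "(1 - x\<^sup>2) * (1 - y\<^sup>2) * B \<le> (1 - x * y)\<^sup>2 * B"
      using B by (rule mult_right_mono)
    then show ?thesis
      using w by (simp add: divide_le_eq mult_ac)
  qed
  finally show ?thesis .
qed

section \<open>The set of radii\<close>

text \<open>A connected set of nonnegative reals containing 0 is an interval from 0 to its supremum.
  Whether the supremum is attained decides between a closed and an open disc.\<close>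

lemma disc_centered_at_0_connected_radii:
  fixes R :: "real set"
  assumes "connected R" "0 \<in> R" "\<And>r. r \<in> R \<Longrightarrow> 0 \<le> r" "bdd_above R"
  shows "disc_centered_at_0 {z. norm z \<in> R}"
proof -
  let ?s = "Sup R"
  have le: "r \<le> ?s" if "r \<in> R" for r
    by (rule cSup_upper[OF that assms(4)])
  have s: "0 \<le> ?s" by (rule le[OF assms(2)])
  have below: "x \<in> R" if "0 \<le> x" "x < ?s" for x
  proof -
    obtain r where "r \<in> R" "x < r"
      using \<open>x < ?s\<close> assms less_cSup_iff[of R x] by auto
    then show ?thesis
      using assms that connected_contains_Icc[of R 0 r] by auto
  qed
  show ?thesis
  proof (cases "?s \<in> R")
    case True
    then have "norm z \<in> R \<longleftrightarrow> norm z \<le> ?s" for z :: complex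
      using le below[of "norm z"] by (metis norm_ge_zero order_le_less)
    then have "{z :: complex. norm z \<in> R} = cball 0 ?s"
      by (intro set_eqI) (simp only: mem_Collect_eq mem_cball_0)
    then show ?thesis using s by (auto simp: disc_centered_at_0_def)
  next
    case False
    then have "norm z \<in> R \<longleftrightarrow> norm z < ?s" for z :: complex
      using le below[of "norm z"] by (metis norm_ge_zero order_le_less)
    then have "{z :: complex. norm z \<in> R} = ball 0 ?s"
      by (intro set_eqI) (simp only: mem_Collect_eq mem_ball_0)
    \<comment> \<open>An open disc needs positive radius: \<open>0\<close> lies in \<open>R\<close>
      and the supremum does not.\<close>
    moreover have "0 < ?s" using False assms(2) s by (metis order_le_less)
    ultimately show ?thesis by (auto simp: disc_centered_at_0_def)
  qed
qed

lemma convex_disc_centered_at_0: "disc_centered_at_0 S \<Longrightarrow> convex S"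
  by (auto simp: disc_centered_at_0_def)

section \<open>Pairs of kernels with prescribed inner product\<close>

lemma mobius_real_unit_interval:
  fixes s y :: real
  assumes "0 \<le> s" "s < 1" "\<bar>y\<bar> < 1"
  shows "0 < 1 + s * y" and "\<bar>(y + s) / (1 + s * y)\<bar> < 1"
proof -
  show pos: "0 < 1 + s * y"
    using assms mult_strict_mono'[of s 1 "\<bar>y\<bar>" 1] abs_ge_minus_self[of "s * y"] by (simp add: abs_mult)
  \<comment> \<open>Clearing the positive denominator turns the upper bound 1 into positivity of
    \<open>(1 - s) * (1 - y)\<close> and the lower bound -1 into positivity of
    \<open>(1 + s) * (1 + y)\<close>.\<close>
  have "0 < (1 - s) * (1 + y)" "0 < (1 - s) * (1 - y)" "0 < (1 + s) * (1 + y)"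
    using assms by auto
  then show "\<bar>(y + s) / (1 + s * y)\<bar> < 1"
    using pos by (simp add: abs_less_iff field_simps)
qed

text \<open>For real points the constraint on the kernels fixes their pseudo-hyperbolic distance.\<close>

lemma kernel_constraint_real_iff:
  fixes x y s :: real
  shows "(1 - x\<^sup>2) * (1 - y\<^sup>2) = (1 - s\<^sup>2) * (1 - x * y)\<^sup>2 \<longleftrightarrow>
    x * (1 + s * y) = y + s \<or> x * (1 - s * y) = y - s"
proof -
  \<comment> \<open>The two factors belong to the two real points at pseudo-hyperbolic distance
    \<open>s\<close> from \<open>y\<close>, one on each side.\<close>
  have "(1 - s\<^sup>2) * (1 - x * y)\<^sup>2 - (1 - x\<^sup>2) * (1 - y\<^sup>2) =
    (x * (1 + s * y) - (y + s)) * (x * (1 - s * y) - (y - s))"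
    by (simp add: power2_eq_square algebra_simps)
  then show ?thesis by (metis eq_iff_diff_eq_0 mult_eq_0_iff)
qed

text \<open>Both points lie on one diameter, with direction \<open>u\<close>. The freedom in the
  sign of \<open>u\<close> merges the two real solutions into one, so that a single real parameter
  \<open>y\<close> remains besides the rotation.\<close>

lemma kernel_constraint_iff:
  assumes s: "0 \<le> s" "s < 1" and l: "l \<in> unit_disc" and m: "m \<in> unit_disc"
  shows "of_real ((1 - (norm l)\<^sup>2) * (1 - (norm m)\<^sup>2)) / (1 - cnj l * m)\<^sup>2 = complex_of_real (1 - s\<^sup>2) \<longleftrightarrow>
    (\<exists>u y. norm u = 1 \<and> \<bar>y\<bar> < 1 \<and> l = u * of_real ((y + s) / (1 + s * y)) \<and> m = u * of_real y)"
    (is "?lhs \<longleftrightarrow> ?rhs")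
proof
  assume ?rhs
  then obtain u y where u: "norm u = 1" and y: "\<bar>y\<bar> < 1"
    and lm: "l = u * of_real ((y + s) / (1 + s * y))" "m = u * of_real y" by blast
  define x where "x = (y + s) / (1 + s * y)"
  have x: "\<bar>x\<bar> < 1" and "x * (1 + s * y) = y + s"
    using mobius_real_unit_interval[OF s y] by (simp_all add: x_def)
  then have "(1 - x\<^sup>2) * (1 - y\<^sup>2) = (1 - s\<^sup>2) * (1 - x * y)\<^sup>2"
    using kernel_constraint_real_iff by blast
  moreover have "\<bar>x * y\<bar> < 1"
    using x y mult_strict_mono'[of "\<bar>x\<bar>" 1 "\<bar>y\<bar>" 1] by (simp add: abs_mult)
  then have "1 - x * y \<noteq> 0" by linarith
  ultimately have "(1 - x\<^sup>2) * (1 - y\<^sup>2) / (1 - x * y)\<^sup>2 = 1 - s\<^sup>2" by simp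
  moreover have "cnj l * m = of_real (x * y)"
    using u complex_norm_square[of u] by (simp add: lm x_def[symmetric] mult_ac)
  moreover have "norm l = \<bar>x\<bar>" "norm m = \<bar>y\<bar>"
    using u by (simp_all add: lm x_def[symmetric] norm_mult)
  ultimately show ?lhs
    by (metis (mono_tags) of_real_1 of_real_diff of_real_divide of_real_power power2_abs)
next
  assume L: ?lhs
  \<comment> \<open>The constraint forces \<open>(1 - cnj l * m)^2\<close> to equal this positive
    number.\<close>
  define p where "p = (1 - (norm l)\<^sup>2) * (1 - (norm m)\<^sup>2) / (1 - s\<^sup>2)"
  have s2: "0 < 1 - s\<^sup>2" using s by (simp add: power_less_one_iff abs_square_less_1)
  have w: "norm (cnj l * m) < 1"
    using l m mult_strict_mono'[of "norm l" 1 "norm m" 1] by (simp add: norm_mult)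
  have "0 < 1 - (norm l)\<^sup>2" "0 < 1 - (norm m)\<^sup>2"
    using l m by (simp_all add: power_less_one_iff abs_square_less_1)
  then have p: "0 < p" using s2 by (simp add: p_def)
  have "1 - cnj l * m \<noteq> 0" using w by auto
  then have Lm: "of_real ((1 - (norm l)\<^sup>2) * (1 - (norm m)\<^sup>2)) = complex_of_real (1 - s\<^sup>2) * (1 - cnj l * m)\<^sup>2"
    using L by (simp add: divide_eq_eq)
  then have "(1 - cnj l * m)\<^sup>2 = of_real p"
    using s2 by (simp add: p_def of_real_divide eq_divide_eq mult.commute del: of_real_diff of_real_mult)
  also have "\<dots> = (of_real (sqrt p))\<^sup>2"
    using p by (simp flip: of_real_power)
  finally have "1 - cnj l * m = of_real (sqrt p) \<or> 1 - cnj l * m = - of_real (sqrt p)"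
    by (simp add: power2_eq_iff)
  \<comment> \<open>Positivity of the real part excludes the negative square root.\<close>
  moreover have "0 < Re (1 - cnj l * m)"
    using w complex_Re_le_cmod[of "cnj l * m"] unfolding minus_complex.sel one_complex.sel by linarith
  have "1 - cnj l * m \<noteq> - of_real (sqrt p)"
  proof
    have "0 < sqrt p" using p by simp
    moreover assume h: "1 - cnj l * m = - of_real (sqrt p)"
    have "Re (1 - cnj l * m) = - sqrt p" unfolding h by simp
    ultimately show False using \<open>0 < Re (1 - cnj l * m)\<close> by linarith
  qed
  ultimately have "cnj l * m = of_real (1 - sqrt p)" by (simp add: algebra_simps)
  then obtain t where t: "cnj l * m = of_real t" by blast
  have "of_real ((1 - (norm l)\<^sup>2) * (1 - (norm m)\<^sup>2)) = complex_of_real ((1 - s\<^sup>2) * (1 - t)\<^sup>2)"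
    using Lm unfolding t by simp
  then have eq: "(1 - (norm l)\<^sup>2) * (1 - (norm m)\<^sup>2) = (1 - s\<^sup>2) * (1 - t)\<^sup>2"
    by (simp only: of_real_eq_iff)
  \<comment> \<open>The direction is that of \<open>m\<close>, with \<open>y = norm m\<close>;
    reality of \<open>cnj l * m\<close> then puts \<open>l\<close> on the same line. For
    \<open>m = 0\<close> the direction is taken from \<open>l\<close>, or is 1 if both points
    vanish.\<close>
  obtain u x y where u: "norm u = 1" and lm: "l = u * of_real x" "m = u * of_real y" and ts: "t = x * y"
  proof (cases "m = 0")
    case True
    define u where "u = (if l = 0 then 1 else l / of_real (norm l))"
    show ?thesis
      by (rule that[of u "norm l" 0]) (use True t in \<open>auto simp: u_def norm_divide\<close>)
  next
    case False
    define y where "y = norm m"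
    have y: "0 < y" using False by (simp add: y_def)
    have "cnj (cnj l * m) = of_real t" using t by simp
    then have "l * cnj m = of_real t" by simp
    then have "l * (m * cnj m) = of_real t * m" by (simp add: mult_ac)
    then have "l = of_real t * m / (of_real y * of_real y)"
      using y by (simp add: complex_norm_square[symmetric] y_def[symmetric] eq_divide_eq power2_eq_square)
    then show ?thesis
      using y by (intro that[of "m / of_real y" "t / y" y]) (auto simp: norm_divide y_def[symmetric])
  qed
  have nlm: "(norm l)\<^sup>2 = x\<^sup>2" "(norm m)\<^sup>2 = y\<^sup>2" and y: "\<bar>y\<bar> < 1"
    using u m by (simp_all add: lm norm_mult)
  have "x * (1 + s * y) = y + s \<or> x * (1 - s * y) = y - s"
    using eq unfolding nlm ts kernel_constraint_real_iff .
  then show ?rhs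
  proof
    assume "x * (1 + s * y) = y + s"
    then have "x = (y + s) / (1 + s * y)"
      using mobius_real_unit_interval(1)[OF s y] by (simp add: eq_divide_eq)
    then show ?thesis using u y lm by blast
  next
    \<comment> \<open>Replacing \<open>u\<close>, \<open>x\<close>, \<open>y\<close> by their
      negatives leaves \<open>l\<close> and \<open>m\<close> unchanged and leads to the first
      branch.\<close>
    assume *: "x * (1 - s * y) = y - s"
    have "0 < 1 + s * (-y)"
      using mobius_real_unit_interval(1)[OF s, of "-y"] y by simp
    then have "- x = (- y + s) / (1 + s * (- y))"
      using * by (simp add: eq_divide_eq algebra_simps)
    moreover have "l = (- u) * of_real (- x)" "m = (- u) * of_real (- y)"
      by (simp_all add: lm)
    ultimately show ?thesis using u y by (metis abs_minus_cancel norm_minus_cancel)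
  qed
qed

theorem theorem3p11:
  fixes q :: real and \<beta> :: "nat \<Rightarrow> real"
  assumes "0 < q" and "q \<le> 1"
    and "bounded (range \<beta>)"
  shows "disc_centered_at_0 (berezin_range (of_real q) (weighted_shift \<beta>)) \<and>
         convex (berezin_range (of_real q) (weighted_shift \<beta>))"
proof -
  obtain B where \<beta>: "\<And>n. \<bar>\<beta> n\<bar> \<le> B"
    using assms(3) by (auto simp: bounded_iff)
  define s where "s = sqrt (1 - q)"
  \<comment> \<open>Here \<open>q <= 1\<close> gives \<open>0 <= s\<close> and
    \<open>q = 1 - s^2\<close>, while \<open>q > 0\<close> gives \<open>s < 1\<close>.\<close>
  have s: "0 \<le> s" "s < 1" and q: "q = 1 - s\<^sup>2"
    using assms by (auto simp: s_def)
  define x where "x y = (y + s) / (1 + s * y)" for y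
  define \<rho> where "\<rho> y = norm (berezin_value \<beta> (of_real (x y)) (of_real y))" for y
  define R where "R = \<rho> ` {-1<..<1}"
  have x: "0 < 1 + s * y" "\<bar>x y\<bar> < 1" if "y \<in> {-1<..<1}" for y
    using mobius_real_unit_interval[OF s, of y] that by (auto simp: x_def abs_less_iff)
  have range: "berezin_range (of_real q) (weighted_shift \<beta>) = {z. norm z \<in> R}"
  proof (intro set_eqI iffI)
    fix z :: complex assume "z \<in> berezin_range (of_real q) (weighted_shift \<beta>)"
    then obtain l m where lm: "l \<in> unit_disc" "m \<in> unit_disc"
      and "bergman_inner (normalized_kernel l) (normalized_kernel m) = of_real q"
      and z: "z = bergman_inner (weighted_shift \<beta> (normalized_kernel l)) (normalized_kernel m)"
      unfolding berezin_range_def by blast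
    then obtain u y where u: "norm u = 1" and y: "\<bar>y\<bar> < 1"
      and "l = u * of_real (x y)" "m = u * of_real y"
      unfolding q x_def using kernel_constraint_iff[OF s lm] by (auto simp: bergman_inner_kernels)
    then have "norm z = \<rho> y"
      unfolding z bergman_inner_weighted_shift_kernels[OF \<beta> lm]
      by (simp add: berezin_value_rotate norm_mult \<rho>_def)
    then show "z \<in> {z. norm z \<in> R}" using y by (auto simp: R_def abs_less_iff)
  next
    fix z :: complex assume "z \<in> {z. norm z \<in> R}"
    then obtain y where y: "y \<in> {-1<..<1}" and zy: "norm z = \<rho> y" by (auto simp: R_def)
    let ?v = "berezin_value \<beta> (of_real (x y)) (of_real y)"
    \<comment> \<open>The rotation carries the value at the real pair to the prescribed
      \<open>z\<close> of the same modulus; if that value is 0, so is \<open>z\<close>, and any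
      rotation will do.\<close>
    obtain u where u: "norm u = 1" and z: "z = u * ?v"
    proof (cases "?v = 0")
      case True
      then show ?thesis using that[of 1] zy by (simp add: \<rho>_def)
    next
      case False
      then show ?thesis using that[of "z / ?v"] zy by (simp add: \<rho>_def norm_divide)
    qed
    let ?l = "u * of_real (x y)" and ?m = "u * of_real y"
    have lm: "?l \<in> unit_disc" "?m \<in> unit_disc"
      using u y x[OF y] by (auto simp: norm_mult)
    have "bergman_inner (normalized_kernel ?l) (normalized_kernel ?m) = of_real q"
      unfolding bergman_inner_kernels[OF lm] q kernel_constraint_iff[OF s lm]
      using u y by (intro exI[of _ u] exI[of _ y]) (auto simp: x_def abs_less_iff)
    moreover have "z = bergman_inner (weighted_shift \<beta> (normalized_kernel ?l)) (normalized_kernel ?m)"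
      unfolding bergman_inner_weighted_shift_kernels[OF \<beta> lm] by (simp add: berezin_value_rotate u z)
    ultimately show "z \<in> berezin_range (of_real q) (weighted_shift \<beta>)"
      unfolding berezin_range_def using lm by blast
  qed
  have "disc_centered_at_0 {z. norm z \<in> R}"
  proof (rule disc_centered_at_0_connected_radii)
    have cx: "continuous_on {-1<..<1} x"
      unfolding x_def using x(1) by (intro continuous_intros) force
    have "continuous_on {-1<..<1} (\<lambda>y. shift_symbol \<beta> (cnj (of_real (x y)) * of_real y))"
    proof (rule continuous_on_compose2[OF continuous_on_shift_symbol[OF \<beta>]])
      show "(\<lambda>y. cnj (of_real (x y)) * of_real y) ` {-1<..<1} \<subseteq> unit_disc"
      proof (clarsimp simp: norm_mult)
        fix y :: real assume y: "-1 < y" "y < 1"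
        then show "\<bar>x y\<bar> * \<bar>y\<bar> < 1"
          using x(2)[of y] mult_strict_mono'[of "\<bar>x y\<bar>" 1 "\<bar>y\<bar>" 1] by (simp add: abs_less_iff)
      qed
    qed (intro continuous_intros cx)
    then have "continuous_on {-1<..<1} \<rho>"
      unfolding \<rho>_def berezin_value_def by (intro continuous_intros cx)
    then show "connected R"
      unfolding R_def by (intro connected_continuous_image) auto
    show "0 \<in> R"
      \<comment> \<open>At \<open>y = 0\<close> the isolated factor \<open>m\<close> of
        \<open>berezin_value\<close> is 0.\<close>
      unfolding R_def by (rule image_eqI[of _ _ 0]) (simp_all add: \<rho>_def berezin_value_def)
    show "0 \<le> r" if "r \<in> R" for r
      using that by (auto simp: R_def \<rho>_def)
    show "bdd_above R"
      unfolding R_def \<rho>_def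
      by (rule bdd_aboveI2[of _ _ B], rule norm_berezin_value_le[OF \<beta>]) (use x(2) in \<open>auto simp: abs_less_iff\<close>)
  qed
  then show ?thesis
    unfolding range by (simp add: convex_disc_centered_at_0)
qed

end
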